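(* The categories $t\mathcal{I}_+$ and $t\Delta_+$ are dual, i.e. $(t\mathcal{I}_+)^{\mathrm{op}}$ is equivalent to $t\Delta_+$; likewise the categories $t\mathcal{I}$ and $t\Delta$ are dual, i.e. $t\mathcal{I}^{\mathrm{op}}$ is equivalent to $t\Delta$.
   Context: Ordinals and intervals. For $n\in\{-1,0,1,\dots\}$ let $[n]=\{0,\dots,n\}$ with its usual order ($[-1]=\emptyset$). $\Delta_+$ is the category of all $[n]$, $n\ge -1$, and order-preserving maps. $\mathcal{I}_+$ is the category whose objects (intervals) are the $[n]$ with $n\ge 0$ and whose morphisms are the order-preserving maps preserving the least and the greatest elements. For $g\colon[m]\to[n]$ in $\Delta_+$ let $[m]^\wedge=[m+1]$ and let $g^\wedge\colon[n+1]\to[m+1]$ be the interval map $g^\wedge(j)=\min(\{i\in[m] : j\le g(i)\}\cup\{m+1\})$; this gives a functor $(-)^\wedge\colon\Delta_+^{\mathrm{op}}\to\mathcal{I}_+$. Trees. A tree $(A,p)$ is a sequence of sets $A_n$ ($n\ge0$) and maps $p_n\colon A_{n+1}\to A_n$ with $A_0$ a singleton $\{\ast\}$; a tree map $f\colon(A,p)\to(B,q)$ is a sequence of maps $f_n\colon A_n\to B_n$ with $q_nf_{n+1}=f_np_n$. The tree has degree $n$ if every composite $A_{n+m}\to A_n$ ($m\ge1$) of the maps $p$ is bijective, and finite degree if it has degree $n$ for some $n\in\mathbb{N}$; it has positive degree if it does not have degree $0$. The category $t\mathcal{I}_+$. An object is a tree $(A,p)$ of finite degree with an interval $F_n(y)\in\mathcal{I}_+$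 for each $y\in A_n$, $n\ge0$ (the labels), and bijections $\lambda_n\colon A_{n+1}\cong\{(y,\xi) : y\in A_n,\ \xi\in F_n(y)\}$ of the form $\lambda_n(x)=(p_n(x),\lambda_{n,x})$, which is cropped: for all $n$ and $x\in A_{n+1}$, $\lambda_{n,x}$ is the least or greatest element of $F_n(p_nx)$ if and only if $F_{n+1}(x)=[0]$. A morphism $(f,\alpha)\colon(A,p,F,\lambda)\to(B,q,G,\eta)$ is a tree map $f$ together with interval maps $\alpha_{n,x}\colon F_n(x)\to G_n(f_nx)$ for all $n$ and $x\in A_n$, such that $\eta_{n,f_{n+1}x}=\alpha_{n,p_nx}(\lambda_{n,x})$ for all $x\in A_{n+1}$. Composition: $(g,\beta)\circ(f,\alpha)=(gf,(\beta_{n,f_nx}\circ\alpha_{n,x}))$. $t\mathcal{I}$ is the full subcategory on the trees of positive degree. The category $t\Delta_+$. An object is a tree $(A,p)$ of finite degree with an ordinal $F_n(y)\in\Delta_+$ for each $y\in A_n$, $n\ge0$, and bijections $\lambda_n\colon A_{n+1}\cong\{(y,\xi) : y\in A_n,\ \xi\in F_n(y)^\wedge\}$ of the form $\lambda_n(x)=(p_n(x),\lambda_{n,x})$, which is cropped: for all $n$ and $x\in A_{n+1}$, $\lambda_{n,x}$ is the least or greatest element of $F_n(p_nx)^\wedge$ if and only if $F_{n+1}(x)^\wedge$ is a singleton (i.e. $F_{n+1}(x)=[-1]$). A morphism $(f,\alpha)\colon(B,q,G,\eta)\to(A,p,F,\lambda)$ is a tree map $f\colon A\to B$ together with order-preserving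 maps $\alpha_{n,x}\colon G_n(f_nx)\to F_n(x)$ for all $n$ and $x\in A_n$, such that $\eta_{n,f_{n+1}x}=(\alpha_{n,p_nx})^\wedge(\lambda_{n,x})$ for all $x\in A_{n+1}$. The composite of $(g,\beta)\colon(C,H)\to(B,G)$ and then $(f,\alpha)\colon(B,G)\to(A,F)$ has tree map $g\circ f\colon A\to C$ and components $\alpha_{n,x}\circ\beta_{n,f_nx}$. $t\Delta$ is the full subcategory on the trees of positive degree. *)

theory Defs
  imports Main "HOL-Library.FuncSet"
begin

section \<open>Categories, functors and equivalence\<close>

text \<open>Hom-sets of different pairs of objects may overlap, so composition, and the action of a
  functor on morphisms, take the objects involved as extra arguments:
  \<open>Comp C X Y Z g f\<close> is \<open>g \<circ> f\<close> for \<open>f : X \<rightarrow> Y\<close> and \<open>g : Y \<rightarrow> Z\<close>.\<close>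

record ('o, 'm) precategory =
  Ob :: "'o set"
  Hom :: "'o \<Rightarrow> 'o \<Rightarrow> 'm set"
  Ident :: "'o \<Rightarrow> 'm"
  Comp :: "'o \<Rightarrow> 'o \<Rightarrow> 'o \<Rightarrow> 'm \<Rightarrow> 'm \<Rightarrow> 'm"

definition category :: "('o, 'm) precategory \<Rightarrow> bool" where
  "category C \<longleftrightarrow>
     (\<forall>X\<in>Ob C. Ident C X \<in> Hom C X X) \<and>
     (\<forall>X\<in>Ob C. \<forall>Y\<in>Ob C. \<forall>Z\<in>Ob C. \<forall>f\<in>Hom C X Y. \<forall>g\<in>Hom C Y Z.
        Comp C X Y Z g f \<in> Hom C X Z) \<and>
     (\<forall>X\<in>Ob C. \<forall>Y\<in>Ob C. \<forall>f\<in>Hom C X Y.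
        Comp C X X Y f (Ident C X) = f \<and> Comp C X Y Y (Ident C Y) f = f) \<and>
     (\<forall>W\<in>Ob C. \<forall>X\<in>Ob C. \<forall>Y\<in>Ob C. \<forall>Z\<in>Ob C.
        \<forall>f\<in>Hom C W X. \<forall>g\<in>Hom C X Y. \<forall>h\<in>Hom C Y Z.
        Comp C W X Z (Comp C X Y Z h g) f = Comp C W Y Z h (Comp C W X Y g f))"

definition opposite :: "('o, 'm) precategory \<Rightarrow> ('o, 'm) precategory" where
  "opposite C =
     \<lparr>Ob = Ob C,
      Hom = (\<lambda>X Y. Hom C Y X),
      Ident = Ident C,
      Comp = (\<lambda>X Y Z g f. Comp C Z Y X f g)\<rparr>"

definition full_subcategory :: "('o, 'm) precategory \<Rightarrow> ('o \<Rightarrow> bool) \<Rightarrow> ('o, 'm) precategory" where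
  "full_subcategory C P = C\<lparr>Ob := {X \<in> Ob C. P X}\<rparr>"

record ('o, 'm, 'p, 'n) functor_data =
  on_ob :: "'o \<Rightarrow> 'p"
  on_hom :: "'o \<Rightarrow> 'o \<Rightarrow> 'm \<Rightarrow> 'n"

definition is_functor ::
  "('o, 'm) precategory \<Rightarrow> ('p, 'n) precategory \<Rightarrow> ('o, 'm, 'p, 'n) functor_data \<Rightarrow> bool" where
  "is_functor C D F \<longleftrightarrow>
     (\<forall>X\<in>Ob C. on_ob F X \<in> Ob D) \<and>
     (\<forall>X\<in>Ob C. \<forall>Y\<in>Ob C. \<forall>f\<in>Hom C X Y.
        on_hom F X Y f \<in> Hom D (on_ob F X) (on_ob F Y)) \<and>
     (\<forall>X\<in>Ob C. on_hom F X X (Ident C X) = Ident D (on_ob F X)) \<and>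
     (\<forall>X\<in>Ob C. \<forall>Y\<in>Ob C. \<forall>Z\<in>Ob C. \<forall>f\<in>Hom C X Y. \<forall>g\<in>Hom C Y Z.
        on_hom F X Z (Comp C X Y Z g f) =
        Comp D (on_ob F X) (on_ob F Y) (on_ob F Z) (on_hom F Y Z g) (on_hom F X Y f))"

definition id_functor :: "('o, 'm, 'o, 'm) functor_data" where
  "id_functor = \<lparr>on_ob = (\<lambda>X. X), on_hom = (\<lambda>X Y f. f)\<rparr>"

definition comp_functor ::
  "('p, 'n, 'q, 'k) functor_data \<Rightarrow> ('o, 'm, 'p, 'n) functor_data \<Rightarrow> ('o, 'm, 'q, 'k) functor_data" where
  "comp_functor G F =
     \<lparr>on_ob = (\<lambda>X. on_ob G (on_ob F X)),
      on_hom = (\<lambda>X Y f. on_hom G (on_ob F X) (on_ob F Y) (on_hom F X Y f))\<rparr>"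

definition isomorphism :: "('o, 'm) precategory \<Rightarrow> 'o \<Rightarrow> 'o \<Rightarrow> 'm \<Rightarrow> bool" where
  "isomorphism C X Y f \<longleftrightarrow>
     f \<in> Hom C X Y \<and>
     (\<exists>g\<in>Hom C Y X. Comp C X Y X g f = Ident C X \<and> Comp C Y X Y f g = Ident C Y)"

definition naturally_isomorphic ::
  "('o, 'm) precategory \<Rightarrow> ('p, 'n) precategory \<Rightarrow>
   ('o, 'm, 'p, 'n) functor_data \<Rightarrow> ('o, 'm, 'p, 'n) functor_data \<Rightarrow> bool" where
  "naturally_isomorphic C D F G \<longleftrightarrow>
     (\<exists>\<theta>. (\<forall>X\<in>Ob C. isomorphism D (on_ob F X) (on_ob G X) (\<theta> X)) \<and>
          (\<forall>X\<in>Ob C. \<forall>Y\<in>Ob C. \<forall>f\<in>Hom C X Y.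
             Comp D (on_ob F X) (on_ob F Y) (on_ob G Y) (\<theta> Y) (on_hom F X Y f) =
             Comp D (on_ob F X) (on_ob G X) (on_ob G Y) (on_hom G X Y f) (\<theta> X)))"

definition equivalent_categories :: "('o, 'm) precategory \<Rightarrow> ('p, 'n) precategory \<Rightarrow> bool" where
  "equivalent_categories C D \<longleftrightarrow>
     category C \<and> category D \<and>
     (\<exists>F G. is_functor C D F \<and> is_functor D C G \<and>
            naturally_isomorphic C C (comp_functor G F) id_functor \<and>
            naturally_isomorphic D D (comp_functor F G) id_functor)"


section \<open>Finite ordinals and intervals\<close>

text \<open>The object \<open>[n]\<close> is encoded by the integer \<open>n\<close>. Here and below, maps between sets are
  extensional (\<open>undefined\<close> outside their domain), so that equality of HOL functions is
  equality of maps.\<close>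

definition ordinal :: "int \<Rightarrow> nat set" where
  "ordinal n = {i. int i \<le> n}"

definition Delta_plus :: "(int, nat \<Rightarrow> nat) precategory" where
  "Delta_plus =
     \<lparr>Ob = {n. - 1 \<le> n},
      Hom = (\<lambda>m n. {g \<in> ordinal m \<rightarrow>\<^sub>E ordinal n. mono_on (ordinal m) g}),
      Ident = (\<lambda>n. \<lambda>i\<in>ordinal n. i),
      Comp = (\<lambda>l m n g f. compose (ordinal l) g f)\<rparr>"

text \<open>For \<open>n \<ge> 0\<close> the least and the greatest element of \<open>[n]\<close> are \<open>0\<close> and \<open>nat n\<close>.\<close>

definition I_plus :: "(int, nat \<Rightarrow> nat) precategory" where
  "I_plus =
     \<lparr>Ob = {n. 0 \<le> n},
      Hom = (\<lambda>m n. {g \<in> ordinal m \<rightarrow>\<^sub>E ordinal n.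
                     mono_on (ordinal m) g \<and> g 0 = 0 \<and> g (nat m) = nat n}),
      Ident = (\<lambda>n. \<lambda>i\<in>ordinal n. i),
      Comp = (\<lambda>l m n g f. compose (ordinal l) g f)\<rparr>"

definition wedge_ob :: "int \<Rightarrow> int" where
  "wedge_ob m = m + 1"

definition wedge_hom :: "int \<Rightarrow> int \<Rightarrow> (nat \<Rightarrow> nat) \<Rightarrow> nat \<Rightarrow> nat" where
  "wedge_hom m n g =
     (\<lambda>j\<in>ordinal (wedge_ob n). Min ({i \<in> ordinal m. j \<le> g i} \<union> {nat (m + 1)}))"


section \<open>Trees\<close>

text \<open>The vertex sets of all levels are subsets of one type \<open>'a\<close>, which plays the role of the
  universe of sets; different levels need not be disjoint.\<close>

record 'a tree =
  level :: "nat \<Rightarrow> 'a set"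
  parent :: "nat \<Rightarrow> 'a \<Rightarrow> 'a"

definition is_tree :: "('a, 'z) tree_scheme \<Rightarrow> bool" where
  "is_tree T \<longleftrightarrow>
     (\<exists>a. level T 0 = {a}) \<and>
     (\<forall>n. parent T n \<in> level T (Suc n) \<rightarrow>\<^sub>E level T n)"

definition tree_map ::
  "('a, 'z) tree_scheme \<Rightarrow> ('a, 'z) tree_scheme \<Rightarrow> (nat \<Rightarrow> 'a \<Rightarrow> 'a) \<Rightarrow> bool" where
  "tree_map T S f \<longleftrightarrow>
     (\<forall>n. f n \<in> level T n \<rightarrow>\<^sub>E level S n) \<and>
     (\<forall>n. \<forall>x\<in>level T (Suc n). parent S n (f (Suc n) x) = f n (parent T n x))"

text \<open>The composite \<open>A\<^bsub>n+m\<^esub> \<rightarrow> A\<^bsub>n\<^esub>\<close> of the parent maps.\<close>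

primrec ancestor :: "('a, 'z) tree_scheme \<Rightarrow> nat \<Rightarrow> nat \<Rightarrow> 'a \<Rightarrow> 'a" where
  "ancestor T n 0 x = x"
| "ancestor T n (Suc m) x = ancestor T n m (parent T (n + m) x)"

definition has_degree :: "('a, 'z) tree_scheme \<Rightarrow> nat \<Rightarrow> bool" where
  "has_degree T n \<longleftrightarrow> (\<forall>m\<ge>1. bij_betw (ancestor T n m) (level T (n + m)) (level T n))"

definition finite_degree :: "('a, 'z) tree_scheme \<Rightarrow> bool" where
  "finite_degree T \<longleftrightarrow> (\<exists>n. has_degree T n)"

definition positive_degree :: "('a, 'z) tree_scheme \<Rightarrow> bool" where
  "positive_degree T \<longleftrightarrow> \<not> has_degree T 0"


section \<open>Labelled trees\<close>

text \<open>\<open>label T n y\<close> is the integer encoding the label \<open>F\<^bsub>n\<^esub>(y)\<close>, and \<open>pos T n x\<close> is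
  \<open>\<lambda>\<^bsub>n,x\<^esub>\<close> for \<open>x \<in> A\<^bsub>n+1\<^esub>\<close>.\<close>

record 'a labelled_tree = "'a tree" +
  label :: "nat \<Rightarrow> 'a \<Rightarrow> int"
  pos :: "nat \<Rightarrow> 'a \<Rightarrow> nat"

text \<open>A morphism is a pair \<open>(f, \<alpha>)\<close> of a tree map and a family of maps between labels.\<close>

type_synonym 'a labelled_map = "(nat \<Rightarrow> 'a \<Rightarrow> 'a) \<times> (nat \<Rightarrow> 'a \<Rightarrow> nat \<Rightarrow> nat)"

subsection \<open>The category of trees labelled by intervals\<close>

definition is_tI_object :: "'a labelled_tree \<Rightarrow> bool" where
  "is_tI_object T \<longleftrightarrow>
     is_tree T \<and> finite_degree T \<and>
     (\<forall>n. label T n \<in> level T n \<rightarrow>\<^sub>E Ob I_plus) \<and>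
     (\<forall>n. pos T n \<in> extensional (level T (Suc n))) \<and>
     (\<forall>n. bij_betw (\<lambda>x. (parent T n x, pos T n x)) (level T (Suc n))
            (SIGMA y:level T n. ordinal (label T n y))) \<and>
     (\<forall>n. \<forall>x\<in>level T (Suc n).
        pos T n x = 0 \<or> pos T n x = nat (label T n (parent T n x)) \<longleftrightarrow> label T (Suc n) x = 0)"

definition is_tI_map :: "'a labelled_tree \<Rightarrow> 'a labelled_tree \<Rightarrow> 'a labelled_map \<Rightarrow> bool" where
  "is_tI_map A B = (\<lambda>(f, \<alpha>).
     tree_map A B f \<and>
     (\<forall>n. \<alpha> n \<in> (\<Pi>\<^sub>E x\<in>level A n. Hom I_plus (label A n x) (label B n (f n x)))) \<and>
     (\<forall>n. \<forall>x\<in>level A (Suc n). pos B n (f (Suc n) x) = \<alpha> n (parent A n x) (pos A n x)))"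

definition tI_plus :: "('a labelled_tree, 'a labelled_map) precategory" where
  "tI_plus =
     \<lparr>Ob = {T. is_tI_object T},
      Hom = (\<lambda>A B. {\<phi>. is_tI_map A B \<phi>}),
      Ident = (\<lambda>A. (\<lambda>n. \<lambda>x\<in>level A n. x, \<lambda>n. \<lambda>x\<in>level A n. Ident I_plus (label A n x))),
      Comp = (\<lambda>A B C (g, \<beta>) (f, \<alpha>).
        (\<lambda>n. compose (level A n) (g n) (f n),
         \<lambda>n. \<lambda>x\<in>level A n.
           Comp I_plus (label A n x) (label B n (f n x)) (label C n (g n (f n x)))
             (\<beta> n (f n x)) (\<alpha> n x)))\<rparr>"

definition tI :: "('a labelled_tree, 'a labelled_map) precategory" where
  "tI = full_subcategory tI_plus positive_degree"

subsection \<open>The category of trees labelled by ordinals\<close>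

definition is_tDelta_object :: "'a labelled_tree \<Rightarrow> bool" where
  "is_tDelta_object T \<longleftrightarrow>
     is_tree T \<and> finite_degree T \<and>
     (\<forall>n. label T n \<in> level T n \<rightarrow>\<^sub>E Ob Delta_plus) \<and>
     (\<forall>n. pos T n \<in> extensional (level T (Suc n))) \<and>
     (\<forall>n. bij_betw (\<lambda>x. (parent T n x, pos T n x)) (level T (Suc n))
            (SIGMA y:level T n. ordinal (wedge_ob (label T n y)))) \<and>
     (\<forall>n. \<forall>x\<in>level T (Suc n).
        pos T n x = 0 \<or> pos T n x = nat (wedge_ob (label T n (parent T n x))) \<longleftrightarrow>
        wedge_ob (label T (Suc n) x) = 0)"

text \<open>A morphism from \<open>B\<close> to \<open>A\<close> has a tree map in the opposite direction, from \<open>A\<close> to \<open>B\<close>.\<close>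

definition is_tDelta_map :: "'a labelled_tree \<Rightarrow> 'a labelled_tree \<Rightarrow> 'a labelled_map \<Rightarrow> bool" where
  "is_tDelta_map B A = (\<lambda>(f, \<alpha>).
     tree_map A B f \<and>
     (\<forall>n. \<alpha> n \<in> (\<Pi>\<^sub>E x\<in>level A n. Hom Delta_plus (label B n (f n x)) (label A n x))) \<and>
     (\<forall>n. \<forall>x\<in>level A (Suc n).
        pos B n (f (Suc n) x) =
        wedge_hom (label B n (f n (parent A n x))) (label A n (parent A n x))
          (\<alpha> n (parent A n x)) (pos A n x)))"

definition tDelta_plus :: "('a labelled_tree, 'a labelled_map) precategory" where
  "tDelta_plus =
     \<lparr>Ob = {T. is_tDelta_object T},
      Hom = (\<lambda>B A. {\<phi>. is_tDelta_map B A \<phi>}),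
      Ident = (\<lambda>A. (\<lambda>n. \<lambda>x\<in>level A n. x, \<lambda>n. \<lambda>x\<in>level A n. Ident Delta_plus (label A n x))),
      Comp = (\<lambda>C B A (f, \<alpha>) (g, \<beta>).
        (\<lambda>n. compose (level A n) (g n) (f n),
         \<lambda>n. \<lambda>x\<in>level A n.
           Comp Delta_plus (label C n (g n (f n x))) (label B n (f n x)) (label A n x)
             (\<alpha> n x) (\<beta> n (f n x))))\<rparr>"

definition tDelta :: "('a labelled_tree, 'a labelled_map) precategory" where
  "tDelta = full_subcategory tDelta_plus positive_degree"

end

theory Submission
  imports Defs
begin

text \<open>
  Both dualities are in fact isomorphisms of categories, induced by the classical duality between
  finite ordinals and finite intervals. For a monotone \<open>g : [m] \<rightarrow> [n]\<close> the interval map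
  \<open>g\<^sup>\<and> : [n+1] \<rightarrow> [m+1]\<close> is characterised by the Galois connection
  \<open>g\<^sup>\<and>(j) \<le> i \<longleftrightarrow> j \<le> g(i)\<close>, for \<open>i \<in> [m]\<close> and \<open>j \<in> [n+1]\<close> (\<open>wedge_hom_le_iff\<close>),
  because an element of \<open>[m+1]\<close> is determined by the set of \<open>i \<in> [m]\<close> above it. From this
  equivalence alone it follows that \<open>g \<mapsto> g\<^sup>\<and>\<close> is contravariantly functorial, and that
  \<open>h \<mapsto> (i \<mapsto> max {j. h j \<le> i})\<close> is its two-sided inverse; on objects the duality is the shift
  \<open>[m] \<mapsto> [m+1]\<close>, a bijection from \<open>n \<ge> -1\<close> onto \<open>n \<ge> 0\<close>.

  The conditions on a tree labelled by ordinals mention its labels \<open>F\<close> only through \<open>F\<^sup>\<and>\<close>, and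
  likewise the compatibility condition on a map \<open>(f, \<alpha>)\<close> only involves \<open>\<alpha>\<^sup>\<and>\<close>. So replacing every
  label by its dual, and every component of a map by its dual, while keeping the underlying tree
  and tree map, is bijective on objects and on hom-sets (\<open>bij_betw_wedge_tree\<close>,
  \<open>bij_betw_wedge_map\<close>). As the underlying tree does not change, neither does its degree, so the
  isomorphism restricts to the trees of positive degree.\<close>

section \<open>Isomorphisms of categories\<close>

definition category_isomorphism ::
  "('o, 'm) precategory \<Rightarrow> ('p, 'n) precategory \<Rightarrow> ('o, 'm, 'p, 'n) functor_data \<Rightarrow> bool" where
  "category_isomorphism C D F \<longleftrightarrow>
     category C \<and> category D \<and> is_functor C D F \<and>
     bij_betw (on_ob F) (Ob C) (Ob D) \<and>
     (\<forall>X\<in>Ob C. \<forall>Y\<in>Ob C. bij_betw (on_hom F X Y) (Hom C X Y) (Hom D (on_ob F X) (on_ob F Y)))"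

lemma category_opposite: "category C \<Longrightarrow> category (opposite C)"
  unfolding category_def opposite_def by simp

lemma category_full_subcategory: "category C \<Longrightarrow> category (full_subcategory C P)"
  unfolding category_def full_subcategory_def by simp

lemma opposite_full_subcategory:
  "opposite (full_subcategory C P) = full_subcategory (opposite C) P"
  unfolding opposite_def full_subcategory_def by simp

lemma equivalent_categories_sym: "equivalent_categories C D \<Longrightarrow> equivalent_categories D C"
  unfolding equivalent_categories_def by blast

lemma isomorphism_Ident:
  assumes "category C" "X \<in> Ob C"
  shows "isomorphism C X X (Ident C X)"
  using assms unfolding isomorphism_def category_def by blast

lemma naturally_isomorphic_idI:
  assumes "category C"
    and "\<And>X. X \<in> Ob C \<Longrightarrow> on_ob H X = X"
    and "\<And>X Y f. X \<in> Ob C \<Longrightarrow> Y \<in> Ob C \<Longrightarrow> f \<in> Hom C X Y \<Longrightarrow> on_hom H X Y f = f"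
  shows "naturally_isomorphic C C H id_functor"
proof -
  have "Comp C X Y Y (Ident C Y) f = Comp C X X Y f (Ident C X)"
    if "X \<in> Ob C" "Y \<in> Ob C" "f \<in> Hom C X Y" for X Y f
    using assms(1) that unfolding category_def by simp
  then show ?thesis
    using assms isomorphism_Ident[OF assms(1)]
    unfolding naturally_isomorphic_def id_functor_def by (intro exI[of _ "Ident C"]) simp
qed

text \<open>The category axioms are equations between morphisms, so they can be checked after applying a
  faithful functor; only closure under identities and composition has to be known beforehand.\<close>

lemma category_if_faithful_functor:
  assumes D: "category D" and F: "is_functor C D F"
    and inj: "\<And>X Y. X \<in> Ob C \<Longrightarrow> Y \<in> Ob C \<Longrightarrow> inj_on (on_hom F X Y) (Hom C X Y)"
    and id: "\<And>X. X \<in> Ob C \<Longrightarrow> Ident C X \<in> Hom C X X"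
    and comp: "\<And>X Y Z f g. X \<in> Ob C \<Longrightarrow> Y \<in> Ob C \<Longrightarrow> Z \<in> Ob C \<Longrightarrow> f \<in> Hom C X Y \<Longrightarrow> g \<in> Hom C Y Z
      \<Longrightarrow> Comp C X Y Z g f \<in> Hom C X Z"
  shows "category C"
proof -
  have ob: "\<And>X. X \<in> Ob C \<Longrightarrow> on_ob F X \<in> Ob D"
    and hom: "\<And>X Y f. X \<in> Ob C \<Longrightarrow> Y \<in> Ob C \<Longrightarrow> f \<in> Hom C X Y \<Longrightarrow>
        on_hom F X Y f \<in> Hom D (on_ob F X) (on_ob F Y)"
    and F_id: "\<And>X. X \<in> Ob C \<Longrightarrow> on_hom F X X (Ident C X) = Ident D (on_ob F X)"
    and F_comp: "\<And>X Y Z f g. X \<in> Ob C \<Longrightarrow> Y \<in> Ob C \<Longrightarrow> Z \<in> Ob C \<Longrightarrow> f \<in> Hom C X Y \<Longrightarrow>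
        g \<in> Hom C Y Z \<Longrightarrow> on_hom F X Z (Comp C X Y Z g f) =
        Comp D (on_ob F X) (on_ob F Y) (on_ob F Z) (on_hom F Y Z g) (on_hom F X Y f)"
    using F unfolding is_functor_def by blast+
  have D_unit: "\<And>X Y f. X \<in> Ob D \<Longrightarrow> Y \<in> Ob D \<Longrightarrow> f \<in> Hom D X Y \<Longrightarrow>
        Comp D X X Y f (Ident D X) = f \<and> Comp D X Y Y (Ident D Y) f = f"
    and D_assoc: "\<And>W X Y Z f g h. W \<in> Ob D \<Longrightarrow> X \<in> Ob D \<Longrightarrow> Y \<in> Ob D \<Longrightarrow> Z \<in> Ob D \<Longrightarrow>
        f \<in> Hom D W X \<Longrightarrow> g \<in> Hom D X Y \<Longrightarrow> h \<in> Hom D Y Z \<Longrightarrow>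
        Comp D W X Z (Comp D X Y Z h g) f = Comp D W Y Z h (Comp D W X Y g f)"
    using D unfolding category_def by blast+
  show ?thesis
    unfolding category_def
  proof (intro conjI ballI)
    fix X Y f assume *: "X \<in> Ob C" "Y \<in> Ob C" "f \<in> Hom C X Y"
    show "Comp C X X Y f (Ident C X) = f"
      by (rule inj_onD[OF inj[OF *(1,2)]]) (simp_all add: * comp id F_id F_comp D_unit ob hom)
    show "Comp C X Y Y (Ident C Y) f = f"
      by (rule inj_onD[OF inj[OF *(1,2)]]) (simp_all add: * comp id F_id F_comp D_unit ob hom)
  next
    fix W X Y Z f g h
    assume *: "W \<in> Ob C" "X \<in> Ob C" "Y \<in> Ob C" "Z \<in> Ob C"
      "f \<in> Hom C W X" "g \<in> Hom C X Y" "h \<in> Hom C Y Z"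
    have c: "Comp C W X Y g f \<in> Hom C W Y" "Comp C X Y Z h g \<in> Hom C X Z"
      using * comp by blast+
    show "Comp C W X Z (Comp C X Y Z h g) f = Comp C W Y Z h (Comp C W X Y g f)"
    proof (rule inj_onD[OF inj[OF *(1,4)]])
      show "on_hom F W Z (Comp C W X Z (Comp C X Y Z h g) f) =
          on_hom F W Z (Comp C W Y Z h (Comp C W X Y g f))"
        using * c by (simp add: F_comp D_assoc ob hom)
    qed (use * c comp in blast)+
  qed (use id comp in blast)+
qed

lemma equivalent_categories_if_isomorphism:
  assumes "category_isomorphism C D F"
  shows "equivalent_categories C D"
proof -
  have C: "category C" and D: "category D" and F: "is_functor C D F"
    and bij_ob: "bij_betw (on_ob F) (Ob C) (Ob D)"
    and bij_hom: "\<And>X Y. X \<in> Ob C \<Longrightarrow> Y \<in> Ob C \<Longrightarrow>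
        bij_betw (on_hom F X Y) (Hom C X Y) (Hom D (on_ob F X) (on_ob F Y))"
    using assms unfolding category_isomorphism_def by auto
  have ob: "\<And>X. X \<in> Ob C \<Longrightarrow> on_ob F X \<in> Ob D"
    and hom: "\<And>X Y f. X \<in> Ob C \<Longrightarrow> Y \<in> Ob C \<Longrightarrow> f \<in> Hom C X Y \<Longrightarrow>
        on_hom F X Y f \<in> Hom D (on_ob F X) (on_ob F Y)"
    and F_id: "\<And>X. X \<in> Ob C \<Longrightarrow> on_hom F X X (Ident C X) = Ident D (on_ob F X)"
    and F_comp: "\<And>X Y Z f g. X \<in> Ob C \<Longrightarrow> Y \<in> Ob C \<Longrightarrow> Z \<in> Ob C \<Longrightarrow> f \<in> Hom C X Y \<Longrightarrow>
        g \<in> Hom C Y Z \<Longrightarrow> on_hom F X Z (Comp C X Y Z g f) =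
        Comp D (on_ob F X) (on_ob F Y) (on_ob F Z) (on_hom F Y Z g) (on_hom F X Y f)"
    using F unfolding is_functor_def by blast+
  have C_id: "\<And>X. X \<in> Ob C \<Longrightarrow> Ident C X \<in> Hom C X X"
    and C_comp: "\<And>X Y Z f g. X \<in> Ob C \<Longrightarrow> Y \<in> Ob C \<Longrightarrow> Z \<in> Ob C \<Longrightarrow> f \<in> Hom C X Y \<Longrightarrow>
        g \<in> Hom C Y Z \<Longrightarrow> Comp C X Y Z g f \<in> Hom C X Z"
    using C unfolding category_def by blast+
  define go where "go = inv_into (Ob C) (on_ob F)"
  define gm where "gm X Y = inv_into (Hom C (go X) (go Y)) (on_hom F (go X) (go Y))" for X Y
  define G where "G = \<lparr>on_ob = go, on_hom = gm\<rparr>"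
  have go_ob: "go X \<in> Ob C" and F_go: "on_ob F (go X) = X" if "X \<in> Ob D" for X
    using bij_ob that unfolding go_def
    by (auto simp: bij_betw_def inv_into_into f_inv_into_f)
  have go_F: "go (on_ob F X) = X" if "X \<in> Ob C" for X
    using bij_ob that unfolding go_def by (simp add: bij_betw_inv_into_left)
  have bij_go: "bij_betw (on_hom F (go X) (go Y)) (Hom C (go X) (go Y)) (Hom D X Y)"
    if "X \<in> Ob D" "Y \<in> Ob D" for X Y
    using bij_hom[OF go_ob go_ob, OF that] that by (simp add: F_go)
  have gm_hom: "gm X Y f \<in> Hom C (go X) (go Y)" and F_gm: "on_hom F (go X) (go Y) (gm X Y f) = f"
    if "X \<in> Ob D" "Y \<in> Ob D" "f \<in> Hom D X Y" for X Y f
    using bij_go[OF that(1,2)] that(3) unfolding gm_def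
    by (auto simp: bij_betw_def inv_into_into f_inv_into_f)
  have gm_F: "gm X Y (on_hom F (go X) (go Y) f) = f"
    if "X \<in> Ob D" "Y \<in> Ob D" "f \<in> Hom C (go X) (go Y)" for X Y f
    using bij_go[OF that(1,2)] that(3) unfolding gm_def by (simp add: bij_betw_inv_into_left)
  have G_functor: "is_functor D C G"
    unfolding is_functor_def G_def functor_data.simps
  proof (intro conjI ballI)
    fix X assume X: "X \<in> Ob D"
    show "gm X X (Ident D X) = Ident C (go X)"
      using gm_F[OF X X C_id[OF go_ob[OF X]]] by (simp add: F_id X go_ob F_go)
  next
    fix X Y Z f g
    assume *: "X \<in> Ob D" "Y \<in> Ob D" "Z \<in> Ob D" "f \<in> Hom D X Y" "g \<in> Hom D Y Z"
    have "Comp C (go X) (go Y) (go Z) (gm Y Z g) (gm X Y f) \<in> Hom C (go X) (go Z)"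
      using * by (simp add: C_comp go_ob gm_hom)
    from gm_F[OF *(1,3) this]
    show "gm X Z (Comp D X Y Z g f) = Comp C (go X) (go Y) (go Z) (gm Y Z g) (gm X Y f)"
      using * by (simp add: F_comp go_ob gm_hom F_gm F_go)
  qed (simp_all add: go_ob gm_hom)
  have "naturally_isomorphic C C (comp_functor G F) id_functor"
  proof (rule naturally_isomorphic_idI[OF C])
    fix X Y f assume *: "X \<in> Ob C" "Y \<in> Ob C" "f \<in> Hom C X Y"
    then show "on_hom (comp_functor G F) X Y f = f"
      using gm_F[of "on_ob F X" "on_ob F Y" f] by (simp add: comp_functor_def G_def go_F ob)
  qed (simp add: comp_functor_def G_def go_F)
  moreover have "naturally_isomorphic D D (comp_functor F G) id_functor"
    by (rule naturally_isomorphic_idI[OF D]) (simp_all add: comp_functor_def G_def F_go F_gm)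
  ultimately show ?thesis
    using C D F G_functor unfolding equivalent_categories_def by blast
qed

lemma category_isomorphism_full_subcategory:
  assumes iso: "category_isomorphism C D F"
    and PQ: "\<And>X. X \<in> Ob C \<Longrightarrow> Q (on_ob F X) \<longleftrightarrow> P X"
  shows "category_isomorphism (full_subcategory C P) (full_subcategory D Q) F"
proof -
  have inj: "inj_on (on_ob F) (Ob C)" and img: "Ob D = on_ob F ` Ob C"
    using iso unfolding category_isomorphism_def bij_betw_def by auto
  have "bij_betw (on_ob F) {X \<in> Ob C. P X} {Y \<in> Ob D. Q Y}"
    using inj PQ unfolding bij_betw_def img by (auto intro: inj_on_subset)
  moreover have "is_functor (full_subcategory C P) (full_subcategory D Q) F"
    using iso PQ unfolding category_isomorphism_def is_functor_def full_subcategory_def by simp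
  ultimately show ?thesis
    using iso category_full_subcategory[of C P] category_full_subcategory[of D Q]
    unfolding category_isomorphism_def by (simp add: full_subcategory_def)
qed


section \<open>The duality of finite ordinals and finite intervals\<close>

lemma finite_ordinal: "finite (ordinal n)"
proof -
  have "ordinal n \<subseteq> {..nat n}" by (auto simp: ordinal_def)
  then show ?thesis by (rule finite_subset) simp
qed

lemma mem_ordinal_iff: "i \<in> ordinal n \<longleftrightarrow> int i \<le> n"
  by (simp add: ordinal_def)

lemma Hom_Delta_plus_iff:
  "g \<in> Hom Delta_plus m n \<longleftrightarrow> g \<in> ordinal m \<rightarrow>\<^sub>E ordinal n \<and> mono_on (ordinal m) g"
  by (simp add: Delta_plus_def)

lemma Hom_I_plus_iff:
  "h \<in> Hom I_plus m n \<longleftrightarrow>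
     h \<in> ordinal m \<rightarrow>\<^sub>E ordinal n \<and> mono_on (ordinal m) h \<and> h 0 = 0 \<and> h (nat m) = nat n"
  by (simp add: I_plus_def)

text \<open>For \<open>a = m+1\<close> the set of upper bounds in \<open>[m]\<close> is empty, and for no smaller \<open>a\<close>; this includes
  the degenerate case \<open>m = -1\<close>, where \<open>[m+1]\<close> has just one element.\<close>

lemma eq_if_same_upper_bounds:
  assumes "int a \<le> m + 1" "int b \<le> m + 1" "\<And>i. i \<in> ordinal m \<Longrightarrow> a \<le> i \<longleftrightarrow> b \<le> i"
  shows "a = b"
  using assms(1,2) assms(3)[of a] assms(3)[of b] by (auto simp: mem_ordinal_iff) linarith+

lemma wedge_hom_mem:
  assumes "- 1 \<le> m" "int j \<le> n + 1"
  shows "int (wedge_hom m n g j) \<le> m + 1"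
proof -
  let ?S = "{i \<in> ordinal m. j \<le> g i} \<union> {nat (m + 1)}"
  have "Min ?S \<in> ?S" by (rule Min_in) (simp_all add: finite_ordinal)
  then show ?thesis
    using assms by (auto simp: wedge_hom_def mem_ordinal_iff wedge_ob_def)
qed

text \<open>The set in the definition of \<open>g\<^sup>\<and>(j)\<close> is upward closed, since \<open>g\<close> is monotone; so its minimum
  lies below \<open>i\<close> exactly when \<open>i\<close> belongs to it.\<close>

lemma wedge_hom_le_iff:
  assumes g: "mono_on (ordinal m) g" and i: "i \<in> ordinal m" and j: "int j \<le> n + 1"
  shows "wedge_hom m n g j \<le> i \<longleftrightarrow> j \<le> g i"
proof -
  let ?S = "{i \<in> ordinal m. j \<le> g i} \<union> {nat (m + 1)}"
  have fin: "finite ?S" by (simp add: finite_ordinal)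
  have w: "wedge_hom m n g j = Min ?S"
    using j by (simp add: wedge_hom_def mem_ordinal_iff wedge_ob_def)
  show ?thesis
  proof
    assume "wedge_hom m n g j \<le> i"
    moreover have "Min ?S \<in> ?S" using fin by (rule Min_in) simp
    ultimately have "Min ?S \<in> ordinal m" "j \<le> g (Min ?S)" "Min ?S \<le> i"
      using i by (auto simp: w mem_ordinal_iff)
    then show "j \<le> g i" using mono_onD[OF g _ i] by (meson order_trans)
  next
    assume "j \<le> g i"
    then show "wedge_hom m n g j \<le> i" unfolding w using fin i by (intro Min_le) auto
  qed
qed

text \<open>All three conditions on an interval map are read off from the Galois connection; the greatest
  element is preserved because \<open>n+1 \<le> g i\<close> holds for no \<open>i\<close>.\<close>

lemma wedge_hom_in_Hom:
  assumes m: "- 1 \<le> m" and n: "- 1 \<le> n" and g: "g \<in> Hom Delta_plus m n"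
  shows "wedge_hom m n g \<in> Hom I_plus (n + 1) (m + 1)"
proof -
  have mono: "mono_on (ordinal m) g" and g_mem: "\<And>i. i \<in> ordinal m \<Longrightarrow> int (g i) \<le> n"
    using g by (auto simp: Hom_Delta_plus_iff mem_ordinal_iff PiE_iff)
  have "wedge_hom m n g \<in> ordinal (n + 1) \<rightarrow>\<^sub>E ordinal (m + 1)"
    using wedge_hom_mem[OF m]
    by (auto simp: PiE_iff mem_ordinal_iff) (simp add: wedge_hom_def wedge_ob_def)
  moreover have "mono_on (ordinal (n + 1)) (wedge_hom m n g)"
  proof (rule mono_onI)
    fix j k assume jk: "j \<in> ordinal (n + 1)" "k \<in> ordinal (n + 1)" "j \<le> k"
    then have le: "int (wedge_hom m n g j) \<le> m + 1" "int (wedge_hom m n g k) \<le> m + 1"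
      using wedge_hom_mem[OF m] by (auto simp: mem_ordinal_iff)
    show "wedge_hom m n g j \<le> wedge_hom m n g k"
    proof (cases "wedge_hom m n g k \<in> ordinal m")
      case True
      then have "k \<le> g (wedge_hom m n g k)"
        using wedge_hom_le_iff[OF mono True, of k n] jk by (simp add: mem_ordinal_iff)
      then show ?thesis
        using wedge_hom_le_iff[OF mono True, of j n] jk by (simp add: mem_ordinal_iff)
    qed (use le in \<open>simp add: mem_ordinal_iff\<close>)
  qed
  moreover have "wedge_hom m n g 0 = 0"
    by (rule eq_if_same_upper_bounds[of _ m])
      (use m n wedge_hom_mem[OF m, of 0 n] wedge_hom_le_iff[OF mono, of _ 0 n] in auto)
  moreover have "wedge_hom m n g (nat (n + 1)) = nat (m + 1)"
  proof (rule eq_if_same_upper_bounds[of _ m])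
    fix i assume i: "i \<in> ordinal m"
    have "\<not> nat (n + 1) \<le> g i" "\<not> nat (m + 1) \<le> i"
      using g_mem[OF i] i by (simp_all add: mem_ordinal_iff nat_le_iff)
    then show "wedge_hom m n g (nat (n + 1)) \<le> i \<longleftrightarrow> nat (m + 1) \<le> i"
      using wedge_hom_le_iff[OF mono i, of "nat (n + 1)" n] n by simp
  qed (use m n wedge_hom_mem[OF m, of "nat (n + 1)" n] in simp_all)
  ultimately show ?thesis by (simp add: Hom_I_plus_iff)
qed

lemma wedge_hom_Ident:
  assumes m: "- 1 \<le> m"
  shows "wedge_hom m m (Ident Delta_plus m) = Ident I_plus (m + 1)"
proof
  fix j
  show "wedge_hom m m (Ident Delta_plus m) j = Ident I_plus (m + 1) j"
  proof (cases "int j \<le> m + 1")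
    case True
    have "wedge_hom m m (\<lambda>i\<in>ordinal m. i) j = j"
    proof (rule eq_if_same_upper_bounds[of _ m])
      fix i assume i: "i \<in> ordinal m"
      show "wedge_hom m m (\<lambda>i\<in>ordinal m. i) j \<le> i \<longleftrightarrow> j \<le> i"
        using wedge_hom_le_iff[OF _ i True, of "\<lambda>i\<in>ordinal m. i"] i by (simp add: mono_on_def)
    qed (use True wedge_hom_mem[OF m True] in simp_all)
    then show ?thesis using True by (simp add: Delta_plus_def I_plus_def mem_ordinal_iff)
  qed (simp add: wedge_hom_def wedge_ob_def I_plus_def mem_ordinal_iff)
qed

text \<open>By the Galois connection, \<open>(g \<circ> f)\<^sup>\<and>(j) \<le> i\<close>, \<open>j \<le> g (f i)\<close>, \<open>g\<^sup>\<and>(j) \<le> f i\<close> and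
  \<open>f\<^sup>\<and>(g\<^sup>\<and>(j)) \<le> i\<close> are all equivalent.\<close>

lemma wedge_hom_Comp:
  assumes l: "- 1 \<le> l" and m: "- 1 \<le> m"
    and f: "f \<in> Hom Delta_plus l m" and g: "g \<in> Hom Delta_plus m n"
  shows "wedge_hom l n (Comp Delta_plus l m n g f) =
    Comp I_plus (n + 1) (m + 1) (l + 1) (wedge_hom l m f) (wedge_hom m n g)"
proof -
  have mono: "mono_on (ordinal l) f" "mono_on (ordinal m) g"
    and f_mem: "\<And>i. i \<in> ordinal l \<Longrightarrow> f i \<in> ordinal m"
    using f g by (auto simp: Hom_Delta_plus_iff)
  have mono': "mono_on (ordinal l) (compose (ordinal l) g f)"
    by (rule mono_onI) (simp add: compose_eq f_mem mono_onD[OF mono(1)] mono_onD[OF mono(2)])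
  have "wedge_hom l n (compose (ordinal l) g f) j = wedge_hom l m f (wedge_hom m n g j)"
    if j: "int j \<le> n + 1" for j
  proof (rule eq_if_same_upper_bounds[of _ l])
    have gj: "int (wedge_hom m n g j) \<le> m + 1" by (rule wedge_hom_mem[OF m j])
    then show "int (wedge_hom l m f (wedge_hom m n g j)) \<le> l + 1" by (rule wedge_hom_mem[OF l])
    fix i assume i: "i \<in> ordinal l"
    show "wedge_hom l n (compose (ordinal l) g f) j \<le> i \<longleftrightarrow>
        wedge_hom l m f (wedge_hom m n g j) \<le> i"
      using wedge_hom_le_iff[OF mono' i j] wedge_hom_le_iff[OF mono(1) i gj]
        wedge_hom_le_iff[OF mono(2) f_mem[OF i] j] i by (simp add: compose_eq)
  qed (rule wedge_hom_mem[OF l j])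
  then show ?thesis
    by (auto simp: fun_eq_iff Delta_plus_def I_plus_def compose_def mem_ordinal_iff
        wedge_hom_def wedge_ob_def)
qed

text \<open>The upper adjoint of an interval map \<open>h : [n+1] \<rightarrow> [m+1]\<close>. Its values lie in \<open>[n]\<close> because
  \<open>h\<close> preserves the greatest element, and the set is nonempty because \<open>h\<close> preserves the least.\<close>

definition vee_hom :: "int \<Rightarrow> int \<Rightarrow> (nat \<Rightarrow> nat) \<Rightarrow> nat \<Rightarrow> nat" where
  "vee_hom m n h = (\<lambda>i\<in>ordinal m. Max {j \<in> ordinal (n + 1). h j \<le> i})"

context
  fixes m n :: int and h :: "nat \<Rightarrow> nat"
  assumes m: "- 1 \<le> m" and n: "- 1 \<le> n" and h: "h \<in> Hom I_plus (n + 1) (m + 1)"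
begin

lemma vee_hom_in_set:
  assumes "i \<in> ordinal m"
  shows "vee_hom m n h i \<in> {j \<in> ordinal (n + 1). h j \<le> i}"
proof -
  have "0 \<in> {j \<in> ordinal (n + 1). h j \<le> i}"
    using h n by (simp add: Hom_I_plus_iff mem_ordinal_iff)
  then have "Max {j \<in> ordinal (n + 1). h j \<le> i} \<in> {j \<in> ordinal (n + 1). h j \<le> i}"
    by (intro Max_in) (auto simp: finite_ordinal)
  then show ?thesis using assms by (simp add: vee_hom_def)
qed

lemma le_vee_hom_iff:
  assumes i: "i \<in> ordinal m" and j: "j \<in> ordinal (n + 1)"
  shows "j \<le> vee_hom m n h i \<longleftrightarrow> h j \<le> i"
proof
  assume "j \<le> vee_hom m n h i"
  then have "h j \<le> h (vee_hom m n h i)"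
    using h j vee_hom_in_set[OF i] by (auto simp: Hom_I_plus_iff dest: mono_onD)
  then show "h j \<le> i" using vee_hom_in_set[OF i] by simp
next
  assume "h j \<le> i"
  then show "j \<le> vee_hom m n h i"
    using i j by (auto simp: vee_hom_def finite_ordinal intro!: Max_ge)
qed

lemma vee_hom_in_Hom: "vee_hom m n h \<in> Hom Delta_plus m n"
  unfolding Hom_Delta_plus_iff
proof (intro conjI mono_onI)
  have "vee_hom m n h i \<in> ordinal n" if i: "i \<in> ordinal m" for i
  proof -
    have "\<not> nat (n + 1) \<le> vee_hom m n h i"
      using le_vee_hom_iff[OF i, of "nat (n + 1)"] h i n m
      by (simp add: mem_ordinal_iff Hom_I_plus_iff)
    then show ?thesis by (simp add: mem_ordinal_iff)
  qed
  then show "vee_hom m n h \<in> ordinal m \<rightarrow>\<^sub>E ordinal n" by (simp add: PiE_iff) (simp add: vee_hom_def)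
next
  fix i k assume "i \<in> ordinal m" "k \<in> ordinal m" "i \<le> k"
  then show "vee_hom m n h i \<le> vee_hom m n h k"
    using vee_hom_in_set[of i] le_vee_hom_iff[of k "vee_hom m n h i"] by simp
qed

lemma wedge_vee_hom: "wedge_hom m n (vee_hom m n h) = h"
proof
  fix j
  have mono: "mono_on (ordinal m) (vee_hom m n h)"
    using vee_hom_in_Hom by (simp add: Hom_Delta_plus_iff)
  show "wedge_hom m n (vee_hom m n h) j = h j"
  proof (cases "int j \<le> n + 1")
    case True
    show ?thesis
    proof (rule eq_if_same_upper_bounds[of _ m])
      show "int (h j) \<le> m + 1" using h True by (auto simp: Hom_I_plus_iff PiE_iff mem_ordinal_iff)
    qed (use wedge_hom_mem[OF m True] wedge_hom_le_iff[OF mono _ True] le_vee_hom_iff True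
          in \<open>auto simp: mem_ordinal_iff\<close>)
  next
    case False
    then have "h j = undefined"
      using h by (auto simp: Hom_I_plus_iff PiE_def extensional_def mem_ordinal_iff)
    then show ?thesis using False by (simp add: wedge_hom_def wedge_ob_def mem_ordinal_iff)
  qed
qed

end

text \<open>A monotone \<open>g\<close> is recovered from its dual, since \<open>g\<^sup>\<and>\<close> determines all relations \<open>j \<le> g i\<close>.\<close>

lemma inj_on_wedge_hom: "inj_on (wedge_hom m n) (Hom Delta_plus m n)"
proof (rule inj_onI, rule ext)
  fix g g' i
  assume g: "g \<in> Hom Delta_plus m n" and g': "g' \<in> Hom Delta_plus m n"
    and eq: "wedge_hom m n g = wedge_hom m n g'"
  show "g i = g' i"
  proof (cases "i \<in> ordinal m")
    case True
    have le: "int (g i) \<le> n" "int (g' i) \<le> n"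
      using g g' True by (auto simp: Hom_Delta_plus_iff PiE_iff mem_ordinal_iff)
    have "j \<le> g i \<longleftrightarrow> j \<le> g' i" if "int j \<le> n + 1" for j
      using wedge_hom_le_iff[OF _ True that, of g] wedge_hom_le_iff[OF _ True that, of g'] g g' eq
      by (simp add: Hom_Delta_plus_iff)
    from this[of "g i"] this[of "g' i"] show ?thesis using le by simp
  next
    case False
    then show ?thesis using g g' by (auto simp: Hom_Delta_plus_iff PiE_def extensional_def)
  qed
qed

text \<open>The equational axioms for trees labelled by ordinals will be pulled back along the faithful
  dualisation from trees labelled by intervals. Monotonicity of composites is not an equation and
  has to be seen directly on ordinals.\<close>

lemma Ident_Delta_plus_in_Hom: "Ident Delta_plus n \<in> Hom Delta_plus n n"
  by (simp add: Delta_plus_def mono_on_def)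

lemma Comp_Delta_plus_in_Hom:
  assumes "f \<in> Hom Delta_plus l m" "g \<in> Hom Delta_plus m n"
  shows "Comp Delta_plus l m n g f \<in> Hom Delta_plus l n"
  using assms by (auto simp: Delta_plus_def compose_eq mono_on_def PiE_iff)

lemma Ident_I_plus_in_Hom: "0 \<le> n \<Longrightarrow> Ident I_plus n \<in> Hom I_plus n n"
  by (simp add: I_plus_def mono_on_def mem_ordinal_iff)

lemma Comp_I_plus_in_Hom:
  assumes "0 \<le> l" "f \<in> Hom I_plus l m" "g \<in> Hom I_plus m n"
  shows "Comp I_plus l m n g f \<in> Hom I_plus l n"
  using assms by (auto simp: I_plus_def compose_eq mono_on_def PiE_iff mem_ordinal_iff)

lemma Comp_I_plus_Ident_right: "f \<in> Hom I_plus m n \<Longrightarrow> Comp I_plus m m n f (Ident I_plus m) = f"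
  by (auto simp: I_plus_def compose_def PiE_def extensional_def fun_eq_iff)

lemma Comp_I_plus_Ident_left: "f \<in> Hom I_plus m n \<Longrightarrow> Comp I_plus m n n (Ident I_plus n) f = f"
  by (auto simp: I_plus_def compose_def PiE_def Pi_def extensional_def fun_eq_iff)

lemma Comp_I_plus_assoc:
  "f \<in> Hom I_plus k l \<Longrightarrow>
    Comp I_plus k l n (Comp I_plus l m n h g) f = Comp I_plus k m n h (Comp I_plus k l m g f)"
  by (auto simp: I_plus_def compose_def PiE_def Pi_def fun_eq_iff)


section \<open>The category of trees labelled by intervals\<close>

lemma Comp_tI_plus [simp]:
  "Comp tI_plus A B C (g, \<beta>) (f, \<alpha>) =
    (\<lambda>n. compose (level A n) (g n) (f n),
     \<lambda>n. \<lambda>x\<in>level A n.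
       Comp I_plus (label A n x) (label B n (f n x)) (label C n (g n (f n x))) (\<beta> n (f n x)) (\<alpha> n x))"
  by (simp add: tI_plus_def)

lemma Ident_tI_plus:
  "Ident tI_plus A = (\<lambda>n. \<lambda>x\<in>level A n. x, \<lambda>n. \<lambda>x\<in>level A n. Ident I_plus (label A n x))"
  by (simp add: tI_plus_def)

lemma Hom_tI_plus_iff:
  "(f, \<alpha>) \<in> Hom tI_plus A B \<longleftrightarrow>
     tree_map A B f \<and>
     (\<forall>n. \<alpha> n \<in> (\<Pi>\<^sub>E x\<in>level A n. Hom I_plus (label A n x) (label B n (f n x)))) \<and>
     (\<forall>n. \<forall>x\<in>level A (Suc n). pos B n (f (Suc n) x) = \<alpha> n (parent A n x) (pos A n x))"
  by (simp add: tI_plus_def is_tI_map_def)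

lemma tree_map_mem: "tree_map A B f \<Longrightarrow> x \<in> level A n \<Longrightarrow> f n x \<in> level B n"
  by (auto simp: tree_map_def)

lemma tree_map_undefined: "tree_map A B f \<Longrightarrow> x \<notin> level A n \<Longrightarrow> f n x = undefined"
  unfolding tree_map_def PiE_def extensional_def by blast

lemma parent_mem: "is_tree A \<Longrightarrow> x \<in> level A (Suc n) \<Longrightarrow> parent A n x \<in> level A n"
  unfolding is_tree_def by auto

lemma tree_map_Ident: "is_tree A \<Longrightarrow> tree_map A A (\<lambda>n. \<lambda>x\<in>level A n. x)"
  by (simp add: tree_map_def parent_mem)

lemma tree_map_compose:
  assumes "is_tree A" "tree_map A B f" "tree_map B C g"
  shows "tree_map A C (\<lambda>n. compose (level A n) (g n) (f n))"
  using assms unfolding tree_map_def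
  by (auto simp: compose_eq parent_mem PiE_iff)

lemma label_nonneg: "A \<in> Ob tI_plus \<Longrightarrow> x \<in> level A n \<Longrightarrow> 0 \<le> label A n x"
  by (auto simp: tI_plus_def is_tI_object_def I_plus_def)

lemma pos_mem:
  assumes "A \<in> Ob tI_plus" "x \<in> level A (Suc n)"
  shows "pos A n x \<in> ordinal (label A n (parent A n x))"
proof -
  have "bij_betw (\<lambda>x. (parent A n x, pos A n x)) (level A (Suc n))
      (SIGMA y:level A n. ordinal (label A n y))"
    using assms(1) by (simp add: tI_plus_def is_tI_object_def)
  from bij_betwE[OF this] assms(2) show ?thesis by blast
qed

lemma is_tree_if_Ob: "A \<in> Ob tI_plus \<Longrightarrow> is_tree A"
  by (simp add: tI_plus_def is_tI_object_def)

lemma Ident_tI_plus_in_Hom: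
  assumes "A \<in> Ob tI_plus"
  shows "Ident tI_plus A \<in> Hom tI_plus A A"
  using assms parent_mem[OF is_tree_if_Ob[OF assms]] pos_mem[OF assms]
  unfolding Ident_tI_plus Hom_tI_plus_iff
  by (auto simp: tree_map_Ident is_tree_if_Ob Ident_I_plus_in_Hom label_nonneg)
     (simp add: I_plus_def)

lemma Comp_tI_plus_in_Hom:
  assumes A: "A \<in> Ob tI_plus" and f: "(f, \<alpha>) \<in> Hom tI_plus A B" and g: "(g, \<beta>) \<in> Hom tI_plus B C"
  shows "Comp tI_plus A B C (g, \<beta>) (f, \<alpha>) \<in> Hom tI_plus A C"
proof -
  have tree: "is_tree A" "tree_map A B f" "tree_map B C g"
    using A f g by (simp_all add: is_tree_if_Ob Hom_tI_plus_iff)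
  have \<alpha>: "\<alpha> n x \<in> Hom I_plus (label A n x) (label B n (f n x))" if "x \<in> level A n" for n x
    using f that by (auto simp: Hom_tI_plus_iff)
  have \<beta>: "\<beta> n y \<in> Hom I_plus (label B n y) (label C n (g n y))" if "y \<in> level B n" for n y
    using g that by (auto simp: Hom_tI_plus_iff)
  have pos: "pos C n (g (Suc n) (f (Suc n) x)) =
      \<beta> n (f n (parent A n x)) (\<alpha> n (parent A n x) (pos A n x))" if "x \<in> level A (Suc n)" for n x
    using that f g tree_map_mem[OF tree(2) that] tree(2)
    by (simp add: Hom_tI_plus_iff tree_map_def)
  show ?thesis
    using tree_map_compose[OF tree] \<alpha> \<beta> tree_map_mem[OF tree(2)] label_nonneg[OF A] pos
      parent_mem[OF tree(1)] pos_mem[OF A]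
    by (auto simp: Hom_tI_plus_iff compose_eq intro!: Comp_I_plus_in_Hom)
       (simp add: I_plus_def compose_eq)
qed

lemma category_tI_plus: "category tI_plus"
  unfolding category_def
proof (intro conjI ballI)
  fix X :: "'a labelled_tree" assume "X \<in> Ob tI_plus"
  then show "Ident tI_plus X \<in> Hom tI_plus X X" by (rule Ident_tI_plus_in_Hom)
next
  fix X Y Z :: "'a labelled_tree" and \<phi> \<psi>
  assume "X \<in> Ob tI_plus" "\<phi> \<in> Hom tI_plus X Y" "\<psi> \<in> Hom tI_plus Y Z"
  then show "Comp tI_plus X Y Z \<psi> \<phi> \<in> Hom tI_plus X Z"
    by (cases \<phi>, cases \<psi>) (simp only: Comp_tI_plus_in_Hom)
next
  fix X Y :: "'a labelled_tree" and \<phi>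
  assume X: "X \<in> Ob tI_plus" and \<phi>: "\<phi> \<in> Hom tI_plus X Y"
  obtain f \<alpha> where [simp]: "\<phi> = (f, \<alpha>)" by (cases \<phi>)
  have f: "tree_map X Y f" using \<phi> by (simp add: Hom_tI_plus_iff)
  have \<alpha>: "\<alpha> n x \<in> Hom I_plus (label X n x) (label Y n (f n x))" if "x \<in> level X n" for n x
    using \<phi> that by (auto simp: Hom_tI_plus_iff)
  have \<alpha>_undefined: "\<alpha> n x = undefined" if "x \<notin> level X n" for n x
    using \<phi> that by (auto simp: Hom_tI_plus_iff)
  show "Comp tI_plus X X Y \<phi> (Ident tI_plus X) = \<phi>"
    using tree_map_undefined[OF f] \<alpha> \<alpha>_undefined
    by (auto simp: Ident_tI_plus fun_eq_iff compose_def restrict_def Comp_I_plus_Ident_right)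
  show "Comp tI_plus X Y Y (Ident tI_plus Y) \<phi> = \<phi>"
    using tree_map_undefined[OF f] tree_map_mem[OF f] \<alpha> \<alpha>_undefined
    by (auto simp: Ident_tI_plus fun_eq_iff compose_def restrict_def Comp_I_plus_Ident_left)
next
  fix W X Y Z :: "'a labelled_tree" and \<phi> \<psi> \<chi> :: "'a labelled_map"
  assume \<phi>: "\<phi> \<in> Hom tI_plus W X"
  obtain f \<alpha> g \<beta> h \<gamma> where [simp]: "\<phi> = (f, \<alpha>)" "\<psi> = (g, \<beta>)" "\<chi> = (h, \<gamma>)"
    by (cases \<phi>, cases \<psi>, cases \<chi>)
  have f: "tree_map W X f" using \<phi> by (simp add: Hom_tI_plus_iff)
  have \<alpha>: "\<alpha> n x \<in> Hom I_plus (label W n x) (label X n (f n x))" if "x \<in> level W n" for n x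
    using \<phi> that by (auto simp: Hom_tI_plus_iff)
  show "Comp tI_plus W X Z (Comp tI_plus X Y Z \<chi> \<psi>) \<phi> =
      Comp tI_plus W Y Z \<chi> (Comp tI_plus W X Y \<psi> \<phi>)"
    using tree_map_mem[OF f] \<alpha>
    by (auto simp: fun_eq_iff compose_def restrict_def Comp_I_plus_assoc)
qed


section \<open>Dualising the labels of a tree\<close>

definition wedge_tree :: "'a labelled_tree \<Rightarrow> 'a labelled_tree" where
  "wedge_tree T = T\<lparr>label := \<lambda>n. \<lambda>x\<in>level T n. wedge_ob (label T n x)\<rparr>"

text \<open>A map from \<open>B\<close> to \<open>A\<close> of trees labelled by ordinals has a tree map from \<open>A\<close> to \<open>B\<close>, and so its
  components are indexed by the vertices of \<open>A\<close>; its dual is a map from the dual of \<open>A\<close> to that of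
  \<open>B\<close> with the same tree map.\<close>

definition wedge_map ::
  "'a labelled_tree \<Rightarrow> 'a labelled_tree \<Rightarrow> 'a labelled_map \<Rightarrow> 'a labelled_map" where
  "wedge_map B A = (\<lambda>(f, \<alpha>).
     (f, \<lambda>n. \<lambda>x\<in>level A n. wedge_hom (label B n (f n x)) (label A n x) (\<alpha> n x)))"

definition wedge_functor ::
  "('a labelled_tree, 'a labelled_map, 'a labelled_tree, 'a labelled_map) functor_data" where
  "wedge_functor = \<lparr>on_ob = wedge_tree, on_hom = wedge_map\<rparr>"

lemma wedge_tree_simps [simp]:
  "level (wedge_tree T) = level T" "parent (wedge_tree T) = parent T" "pos (wedge_tree T) = pos T"
  "label (wedge_tree T) n = (\<lambda>x\<in>level T n. wedge_ob (label T n x))"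
  by (simp_all add: wedge_tree_def)

lemma tree_predicates_cong:
  fixes S T :: "('a, 'z) tree_scheme"
  assumes "level S = level T" "parent S = parent T"
  shows "is_tree S \<longleftrightarrow> is_tree T" "has_degree S n \<longleftrightarrow> has_degree T n"
    "finite_degree S \<longleftrightarrow> finite_degree T" "positive_degree S \<longleftrightarrow> positive_degree T"
proof -
  have "ancestor S n m x = ancestor T n m x" for n m x
    by (induction m arbitrary: x) (simp_all add: assms)
  then have "ancestor S n m = ancestor T n m" for n m by (rule ext)
  then have *: "has_degree S n = has_degree T n" for n by (simp add: has_degree_def assms)
  show "is_tree S \<longleftrightarrow> is_tree T" "has_degree S n \<longleftrightarrow> has_degree T n"
    "finite_degree S \<longleftrightarrow> finite_degree T" "positive_degree S \<longleftrightarrow> positive_degree T"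
    by (simp_all add: is_tree_def finite_degree_def positive_degree_def assms *)
qed

lemmas wedge_tree_predicates = tree_predicates_cong[of "wedge_tree T" T for T, simplified]

lemma tree_map_wedge_tree [simp]: "tree_map (wedge_tree A) (wedge_tree B) = tree_map A B"
  by (simp add: tree_map_def fun_eq_iff)

text \<open>The dual labels are extensional by construction, which says nothing about the values of the
  original ones off the vertex sets; hence the hypothesis.\<close>

lemma is_tI_object_wedge_tree_iff:
  assumes "\<And>n. label T n \<in> extensional (level T n)"
  shows "is_tI_object (wedge_tree T) \<longleftrightarrow> is_tDelta_object T"
proof (cases "is_tree T")
  case True
  have "(SIGMA y:level T n. ordinal (label (wedge_tree T) n y)) =
      (SIGMA y:level T n. ordinal (wedge_ob (label T n y)))" for n
    by auto
  moreover have "label (wedge_tree T) n \<in> level T n \<rightarrow>\<^sub>E Ob I_plus \<longleftrightarrow>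
      label T n \<in> level T n \<rightarrow>\<^sub>E Ob Delta_plus" for n
    using assms by (auto simp: PiE_iff I_plus_def Delta_plus_def wedge_ob_def)
  ultimately show ?thesis
    using parent_mem[OF True]
    by (simp add: is_tI_object_def is_tDelta_object_def wedge_tree_predicates)
qed (simp add: is_tI_object_def is_tDelta_object_def wedge_tree_predicates)

lemma bij_betw_wedge_tree:
  "bij_betw wedge_tree (Ob tDelta_plus) (Ob tI_plus :: 'a labelled_tree set)"
proof -
  define vee_tree :: "'a labelled_tree \<Rightarrow> 'a labelled_tree"
    where "vee_tree T = T\<lparr>label := \<lambda>n. \<lambda>x\<in>level T n. label T n x - 1\<rparr>" for T
  have ext: "(\<lambda>n. \<lambda>x\<in>level T n. label T n x) = label T"
    if "\<And>n. label T n \<in> extensional (level T n)" for T :: "'a labelled_tree"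
    using that by (auto simp: fun_eq_iff extensional_def)
  have wedge_vee: "wedge_tree (vee_tree T) = T" and vee_wedge: "vee_tree (wedge_tree T) = T"
    if "\<And>n. label T n \<in> extensional (level T n)" for T :: "'a labelled_tree"
    using ext[OF that]
    by (simp_all add: vee_tree_def wedge_tree_def wedge_ob_def cong: restrict_cong)
  have ext_I: "label T n \<in> extensional (level T n)" if "T \<in> Ob tI_plus" for T :: "'a labelled_tree" and n
    using that by (simp add: tI_plus_def is_tI_object_def PiE_iff)
  have ext_Delta: "label T n \<in> extensional (level T n)" if "T \<in> Ob tDelta_plus"
    for T :: "'a labelled_tree" and n
    using that by (simp add: tDelta_plus_def is_tDelta_object_def PiE_iff)
  show ?thesis
  proof (rule bij_betwI[where g = vee_tree])
    show "wedge_tree \<in> Ob tDelta_plus \<rightarrow> (Ob tI_plus :: 'a labelled_tree set)"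
    proof (rule Pi_I)
      fix T :: "'a labelled_tree" assume T: "T \<in> Ob tDelta_plus"
      then show "wedge_tree T \<in> Ob tI_plus"
        using is_tI_object_wedge_tree_iff[OF ext_Delta[OF T]] by (simp add: tI_plus_def tDelta_plus_def)
    qed
    show "vee_tree \<in> Ob tI_plus \<rightarrow> Ob tDelta_plus"
    proof (rule Pi_I)
      fix T :: "'a labelled_tree" assume T: "T \<in> Ob tI_plus"
      have "is_tI_object (wedge_tree (vee_tree T)) \<longleftrightarrow> is_tDelta_object (vee_tree T)"
        by (rule is_tI_object_wedge_tree_iff) (simp add: vee_tree_def)
      then show "vee_tree T \<in> Ob tDelta_plus"
        using T wedge_vee[OF ext_I[OF T]] by (simp add: tI_plus_def tDelta_plus_def)
    qed
    show "vee_tree (wedge_tree T) = T" if "T \<in> Ob tDelta_plus" for T :: "'a labelled_tree"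
      using that by (rule vee_wedge[OF ext_Delta])
    show "wedge_tree (vee_tree T) = T" if "T \<in> Ob tI_plus" for T :: "'a labelled_tree"
      using that by (rule wedge_vee[OF ext_I])
  qed
qed

lemma Comp_tDelta_plus [simp]:
  "Comp tDelta_plus C B A (f, \<alpha>) (g, \<beta>) =
    (\<lambda>n. compose (level A n) (g n) (f n),
     \<lambda>n. \<lambda>x\<in>level A n.
       Comp Delta_plus (label C n (g n (f n x))) (label B n (f n x)) (label A n x)
         (\<alpha> n x) (\<beta> n (f n x)))"
  by (simp add: tDelta_plus_def)

lemma Ident_tDelta_plus:
  "Ident tDelta_plus A =
    (\<lambda>n. \<lambda>x\<in>level A n. x, \<lambda>n. \<lambda>x\<in>level A n. Ident Delta_plus (label A n x))"
  by (simp add: tDelta_plus_def)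

lemma label_ge: "A \<in> Ob tDelta_plus \<Longrightarrow> x \<in> level A n \<Longrightarrow> - 1 \<le> label A n x"
  by (auto simp: tDelta_plus_def is_tDelta_object_def Delta_plus_def)

lemma is_tree_if_Ob_tDelta: "A \<in> Ob tDelta_plus \<Longrightarrow> is_tree A"
  by (simp add: tDelta_plus_def is_tDelta_object_def)

text \<open>The compatibility condition on \<open>(f, \<alpha>)\<close> is word for word the one on its dual. Monotonicity of
  the components is a separate condition, since the formula for \<open>\<alpha>\<^sup>\<and>\<close> makes sense for any function
  and does not detect it.\<close>

lemma Hom_tDelta_plus_iff:
  assumes A: "A \<in> Ob tDelta_plus" and B: "B \<in> Ob tDelta_plus"
  shows "(f, \<alpha>) \<in> Hom tDelta_plus B A \<longleftrightarrow>
    (\<forall>n. \<alpha> n \<in> (\<Pi>\<^sub>E x\<in>level A n. Hom Delta_plus (label B n (f n x)) (label A n x))) \<and>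
    wedge_map B A (f, \<alpha>) \<in> Hom tI_plus (wedge_tree A) (wedge_tree B)"
proof -
  have "wedge_hom (label B n (f n x)) (label A n x) (\<alpha> n x)
      \<in> Hom I_plus (wedge_ob (label A n x)) (wedge_ob (label B n (f n x)))"
    if "tree_map A B f" "x \<in> level A n"
      "\<alpha> n \<in> (\<Pi>\<^sub>E x\<in>level A n. Hom Delta_plus (label B n (f n x)) (label A n x))" for n x
    using that label_ge[OF A] label_ge[OF B] tree_map_mem[OF that(1,2)]
    by (auto simp: wedge_ob_def intro!: wedge_hom_in_Hom)
  then show ?thesis
    using parent_mem[OF is_tree_if_Ob_tDelta[OF A]]
    by (auto simp: tDelta_plus_def is_tDelta_map_def Hom_tI_plus_iff wedge_map_def tree_map_mem)
qed

lemma Hom_tDelta_plusD: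
  assumes "(f, \<alpha>) \<in> Hom tDelta_plus B A"
  shows "tree_map A B f"
    and "x \<in> level A n \<Longrightarrow> \<alpha> n x \<in> Hom Delta_plus (label B n (f n x)) (label A n x)"
    and "x \<notin> level A n \<Longrightarrow> \<alpha> n x = undefined"
  using assms by (auto simp: tDelta_plus_def is_tDelta_map_def)

lemma wedge_map_Ident:
  assumes A: "A \<in> Ob tDelta_plus"
  shows "wedge_map A A (Ident tDelta_plus A) = Ident tI_plus (wedge_tree A)"
  using label_ge[OF A]
  by (auto simp: Ident_tDelta_plus Ident_tI_plus wedge_map_def wedge_hom_Ident wedge_ob_def fun_eq_iff)

lemma wedge_map_Comp:
  assumes A: "A \<in> Ob tDelta_plus" and B: "B \<in> Ob tDelta_plus" and C: "C \<in> Ob tDelta_plus"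
    and \<psi>: "\<psi> \<in> Hom tDelta_plus C B" and \<phi>: "\<phi> \<in> Hom tDelta_plus B A"
  shows "wedge_map C A (Comp tDelta_plus C B A \<phi> \<psi>) =
    Comp tI_plus (wedge_tree A) (wedge_tree B) (wedge_tree C) (wedge_map C B \<psi>) (wedge_map B A \<phi>)"
proof -
  obtain f \<alpha> g \<beta> where [simp]: "\<phi> = (f, \<alpha>)" "\<psi> = (g, \<beta>)" by (cases \<phi>, cases \<psi>)
  have f: "tree_map A B f" and g: "tree_map B C g" using \<phi> \<psi> Hom_tDelta_plusD(1) by auto
  have "wedge_hom (label C n (g n (f n x))) (label A n x)
      (Comp Delta_plus (label C n (g n (f n x))) (label B n (f n x)) (label A n x)
        (\<alpha> n x) (\<beta> n (f n x))) =
      Comp I_plus (wedge_ob (label A n x)) (wedge_ob (label B n (f n x)))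
        (wedge_ob (label C n (g n (f n x))))
        (wedge_hom (label C n (g n (f n x))) (label B n (f n x)) (\<beta> n (f n x)))
        (wedge_hom (label B n (f n x)) (label A n x) (\<alpha> n x))" if x: "x \<in> level A n" for n x
    unfolding wedge_ob_def
    using \<phi> \<psi> x tree_map_mem[OF f x] tree_map_mem[OF g tree_map_mem[OF f x]]
    by (intro wedge_hom_Comp label_ge[OF B] label_ge[OF C] Hom_tDelta_plusD(2)) auto
  then show ?thesis
    using tree_map_mem[OF f] tree_map_mem[OF g]
    by (auto simp: wedge_map_def fun_eq_iff compose_eq)
qed

text \<open>The tree map is kept, so this reduces to the components: a monotone map is determined by its
  dual, and \<open>vee_hom\<close> provides a monotone map with a given dual.\<close>

lemma bij_betw_wedge_map:
  assumes A: "A \<in> Ob tDelta_plus" and B: "B \<in> Ob tDelta_plus"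
  shows "bij_betw (wedge_map B A) (Hom tDelta_plus B A) (Hom tI_plus (wedge_tree A) (wedge_tree B))"
  unfolding bij_betw_def
proof (intro conjI equalityI subsetI)
  show "inj_on (wedge_map B A) (Hom tDelta_plus B A)"
  proof (rule inj_onI)
    fix \<phi> \<psi>
    assume \<phi>: "\<phi> \<in> Hom tDelta_plus B A" and \<psi>: "\<psi> \<in> Hom tDelta_plus B A"
      and eq: "wedge_map B A \<phi> = wedge_map B A \<psi>"
    obtain f \<alpha> g \<beta> where [simp]: "\<phi> = (f, \<alpha>)" "\<psi> = (g, \<beta>)" by (cases \<phi>, cases \<psi>)
    have [simp]: "g = f" using eq by (simp add: wedge_map_def)
    have hom: "(f, \<alpha>) \<in> Hom tDelta_plus B A" "(f, \<beta>) \<in> Hom tDelta_plus B A"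
      using \<phi> \<psi> by simp_all
    have "\<alpha> n x = \<beta> n x" for n x
    proof (cases "x \<in> level A n")
      case True
      have "wedge_hom (label B n (f n x)) (label A n x) (\<alpha> n x) =
          wedge_hom (label B n (f n x)) (label A n x) (\<beta> n x)"
        using arg_cong[OF eq, of "\<lambda>\<chi>. snd \<chi> n x"] True by (simp add: wedge_map_def)
      then show ?thesis
        by (rule inj_onD[OF inj_on_wedge_hom])
          (simp_all add: Hom_tDelta_plusD(2)[OF hom(1) True] Hom_tDelta_plusD(2)[OF hom(2) True])
    next
      case False
      then show ?thesis using Hom_tDelta_plusD(3)[OF hom(1)] Hom_tDelta_plusD(3)[OF hom(2)] by simp
    qed
    then show "\<phi> = \<psi>" by (simp add: fun_eq_iff)
  qed
next
  fix \<psi> assume "\<psi> \<in> wedge_map B A ` Hom tDelta_plus B A"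
  then obtain f \<alpha> where "(f, \<alpha>) \<in> Hom tDelta_plus B A" "\<psi> = wedge_map B A (f, \<alpha>)" by auto
  then show "\<psi> \<in> Hom tI_plus (wedge_tree A) (wedge_tree B)"
    by (simp only: Hom_tDelta_plus_iff[OF A B])
next
  fix \<psi> assume \<psi>: "\<psi> \<in> Hom tI_plus (wedge_tree A) (wedge_tree B)"
  obtain f \<beta> where [simp]: "\<psi> = (f, \<beta>)" by (cases \<psi>)
  have f: "tree_map A B f" using \<psi> by (simp add: Hom_tI_plus_iff)
  have \<beta>: "\<beta> n x \<in> Hom I_plus (label A n x + 1) (label B n (f n x) + 1)" if "x \<in> level A n" for n x
  proof -
    have "\<beta> n \<in> (\<Pi>\<^sub>E x\<in>level A n.
        Hom I_plus (label (wedge_tree A) n x) (label (wedge_tree B) n (f n x)))"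
      using \<psi> unfolding \<open>\<psi> = (f, \<beta>)\<close> Hom_tI_plus_iff wedge_tree_simps(1) by blast
    from PiE_mem[OF this that] show ?thesis
      using that tree_map_mem[OF f that] by (simp add: wedge_ob_def)
  qed
  have \<beta>_undefined: "\<beta> n x = undefined" if "x \<notin> level A n" for n x
    using \<psi> that by (auto simp: Hom_tI_plus_iff)
  define \<alpha> where
    "\<alpha> = (\<lambda>n. \<lambda>x\<in>level A n. vee_hom (label B n (f n x)) (label A n x) (\<beta> n x))"
  have ge: "- 1 \<le> label B n (f n x)" "- 1 \<le> label A n x" if "x \<in> level A n" for n x
    using that label_ge[OF A] label_ge[OF B] tree_map_mem[OF f] by blast+
  have "wedge_map B A (f, \<alpha>) = \<psi>"
    using \<beta>_undefined wedge_vee_hom[OF ge \<beta>]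
    by (auto simp: wedge_map_def \<alpha>_def fun_eq_iff restrict_def)
  moreover have "(f, \<alpha>) \<in> Hom tDelta_plus B A"
    unfolding Hom_tDelta_plus_iff[OF A B] calculation
    using \<psi> vee_hom_in_Hom[OF ge \<beta>] by (auto simp: \<alpha>_def)
  ultimately show "\<psi> \<in> wedge_map B A ` Hom tDelta_plus B A" by (metis image_eqI)
qed

lemma Ident_tDelta_plus_in_Hom:
  assumes A: "A \<in> Ob tDelta_plus"
  shows "Ident tDelta_plus A \<in> Hom tDelta_plus A A"
proof -
  have "wedge_map A A (Ident tDelta_plus A) \<in> Hom tI_plus (wedge_tree A) (wedge_tree A)"
    unfolding wedge_map_Ident[OF A]
    using A bij_betwE[OF bij_betw_wedge_tree] by (blast intro: Ident_tI_plus_in_Hom)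
  then show ?thesis
    using Hom_tDelta_plus_iff[OF A A, of "fst (Ident tDelta_plus A)" "snd (Ident tDelta_plus A)"]
    by (simp add: Ident_tDelta_plus Ident_Delta_plus_in_Hom)
qed

lemma Comp_tDelta_plus_in_Hom:
  assumes A: "A \<in> Ob tDelta_plus" and B: "B \<in> Ob tDelta_plus" and C: "C \<in> Ob tDelta_plus"
    and \<psi>: "\<psi> \<in> Hom tDelta_plus C B" and \<phi>: "\<phi> \<in> Hom tDelta_plus B A"
  shows "Comp tDelta_plus C B A \<phi> \<psi> \<in> Hom tDelta_plus C A"
proof -
  obtain f \<alpha> g \<beta> where [simp]: "\<phi> = (f, \<alpha>)" "\<psi> = (g, \<beta>)" by (cases \<phi>, cases \<psi>)
  have f: "tree_map A B f" using \<phi> Hom_tDelta_plusD(1) by auto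
  have "wedge_map C B \<psi> \<in> Hom tI_plus (wedge_tree B) (wedge_tree C)"
    "wedge_map B A \<phi> \<in> Hom tI_plus (wedge_tree A) (wedge_tree B)"
    using \<phi> \<psi> bij_betwE[OF bij_betw_wedge_map] A B C by blast+
  then have "wedge_map C A (Comp tDelta_plus C B A \<phi> \<psi>) \<in> Hom tI_plus (wedge_tree A) (wedge_tree C)"
    unfolding wedge_map_Comp[OF A B C \<psi> \<phi>]
    using category_tI_plus A B C bij_betwE[OF bij_betw_wedge_tree] unfolding category_def by blast
  moreover have "Comp Delta_plus (label C n (g n (f n x))) (label B n (f n x)) (label A n x)
      (\<alpha> n x) (\<beta> n (f n x)) \<in> Hom Delta_plus (label C n (g n (f n x))) (label A n x)"
    if x: "x \<in> level A n" for n x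
    using \<phi> \<psi> x tree_map_mem[OF f x] by (intro Comp_Delta_plus_in_Hom Hom_tDelta_plusD(2)) auto
  ultimately show ?thesis
    using Hom_tDelta_plus_iff[OF A C] by (auto simp: compose_eq)
qed

lemma category_isomorphism_wedge:
  "category_isomorphism (tDelta_plus :: ('a labelled_tree, 'a labelled_map) precategory)
     (opposite tI_plus) wedge_functor"
proof -
  let ?D = "tDelta_plus :: ('a labelled_tree, 'a labelled_map) precategory"
  have D: "category (opposite (tI_plus :: ('a labelled_tree, 'a labelled_map) precategory))"
    by (rule category_opposite[OF category_tI_plus])
  have F: "is_functor ?D (opposite tI_plus) wedge_functor"
    unfolding is_functor_def wedge_functor_def opposite_def functor_data.simps precategory.simps
  proof (intro conjI ballI)
    fix X assume "X \<in> Ob ?D"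
    then show "wedge_tree X \<in> Ob tI_plus" by (rule bij_betw_apply[OF bij_betw_wedge_tree])
  next
    fix X Y f assume "X \<in> Ob ?D" "Y \<in> Ob ?D" "f \<in> Hom ?D X Y"
    then show "wedge_map X Y f \<in> Hom tI_plus (wedge_tree Y) (wedge_tree X)"
      using bij_betw_apply[OF bij_betw_wedge_map] by blast
  qed (simp_all only: wedge_map_Ident wedge_map_Comp)
  have "category ?D"
    by (rule category_if_faithful_functor[OF D F])
      (use bij_betw_wedge_map in \<open>auto simp: wedge_functor_def bij_betw_def
        Ident_tDelta_plus_in_Hom Comp_tDelta_plus_in_Hom\<close>)
  then show ?thesis
    using D F unfolding category_isomorphism_def
    by (simp add: wedge_functor_def opposite_def bij_betw_wedge_tree bij_betw_wedge_map)
qed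

theorem corollary7p15:
  shows "equivalent_categories
           (opposite (tI_plus :: ('a labelled_tree, 'a labelled_map) precategory))
           (tDelta_plus :: ('a labelled_tree, 'a labelled_map) precategory) \<and>
         equivalent_categories
           (opposite (tI :: ('a labelled_tree, 'a labelled_map) precategory))
           (tDelta :: ('a labelled_tree, 'a labelled_map) precategory)"
proof (intro conjI equivalent_categories_sym[OF equivalent_categories_if_isomorphism])
  show "category_isomorphism (tDelta_plus :: ('a labelled_tree, 'a labelled_map) precategory)
      (opposite tI_plus) wedge_functor"
    by (rule category_isomorphism_wedge)
  show "category_isomorphism (tDelta :: ('a labelled_tree, 'a labelled_map) precategory)
      (opposite tI) wedge_functor"
    unfolding tDelta_def tI_def opposite_full_subcategory
    by (rule category_isomorphism_full_subcategory[OF category_isomorphism_wedge])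
      (simp add: wedge_functor_def wedge_tree_predicates)
qed

end
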